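(* Let $X$ and $Y$ be Banach spaces, let $\pi:X\to Y$ be a nonlinear operator of the form $\pi(x)=\ell_0+\pi_0(x)+F(x)$, where $\ell_0\in Y$, $\pi_0:X\to Y$ is a bounded linear operator and $F:X\to Y$ is a (possibly nonlinear) map. Let $K\neq\emptyset$ be a bounded subset of $X$ and suppose that $F$ is bounded on $K$. Then, for each $n\in\mathbb N$, $n\ge 1$, $$d_n(\pi(K))_Y\le \|\pi_0\|\, d_n(K)_X+\sup_{x\in K}\|F(x)\|_Y .$$
   Context: Banach spaces are over a common scalar field, $\mathbb R$ or $\mathbb C$. $\|\pi_0\|=\sup_{x\ne 0}\|\pi_0(x)\|_Y/\|x\|_X$ is the operator norm. For a Banach space $Z$, $\mathrm{Aff}_n(Z)$ denotes the set of all affine subspaces of $Z$ of dimension at most $n$, i.e. sets $W=c+W_0$ with $c\in Z$ and $W_0\subset Z$ a linear subspace of dimension at most $n$. For a nonempty set $S\subset Z$ and $n\ge1$, the affine Kolmogorov $n$-width is $$d_n(S)_Z=\inf_{W\in \mathrm{Aff}_n(Z)}\ \sup_{x\in S}\ \inf_{\xi\in W}\|x-\xi\|_Z .$$ *)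

theory Defs
  imports "HOL-Analysis.Analysis"
begin

(* Banach spaces over a scalar field 'k, which can be instantiated with both real and complex.
   The type class banach only provides scalar multiplication by reals, so the scalar
   multiplication by 'k is a parameter. *)

locale banach_space_over = vector_space scale
  for scale :: "'k::real_normed_field \<Rightarrow> 'z::banach \<Rightarrow> 'z" +
  assumes scale_of_real: "scale (of_real r) x = r *\<^sub>R x"
    and norm_scale: "norm (scale a x) = norm a * norm x"
begin

(* The library's dim is 0 for infinite-dimensional spaces, hence the explicit finite spanning set. *)
definition Aff :: "nat \<Rightarrow> 'z set set" where
  "Aff n = {(\<lambda>w. c + w) ` W0 | c W0.
     subspace W0 \<and> (\<exists>B. finite B \<and> span B = W0) \<and> dim W0 \<le> n}"

(* Extended reals make the value meaningful for unbounded S as well. *)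
definition affine_width :: "nat \<Rightarrow> 'z set \<Rightarrow> ereal" where
  "affine_width n S = (INF W\<in>Aff n. SUP x\<in>S. INF \<xi>\<in>W. ereal (norm (x - \<xi>)))"

end

lemma banach_space_over_real:
  "banach_space_over ((*\<^sub>R) :: real \<Rightarrow> 'z::banach \<Rightarrow> 'z)"
  by unfold_locales (simp_all add: scaleR_add_right scaleR_add_left)

lemma banach_space_over_complex: "banach_space_over ((*) :: complex \<Rightarrow> complex \<Rightarrow> complex)"
  by unfold_locales (simp_all add: algebra_simps norm_mult scaleR_conv_of_real)

end

theory Submission
  imports Defs
begin

text \<open>The shift \<open>l0\<close> and the linear part can be absorbed into the approximating
  set, so only \<open>F\<close> adds an error. If \<open>W\<close> is admissible in the source
  space, then \<open>l0 + \<pi>0(W)\<close> is admissible in the target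
  (\<open>affine_image_in_Aff\<close>), because a linear map does not raise finite dimension
  (\<open>dim_image_le_finite_span\<close>). For \<open>x\<close> in \<open>K\<close> and
  \<open>\<xi>\<close> in \<open>W\<close>, the difference
  \<open>\<pi> x - (l0 + \<pi>0 \<xi>)\<close> equals \<open>\<pi>0 (x - \<xi>) + F x\<close>, of
  norm at most \<open>onorm \<pi>0 * norm (x - \<xi>) + norm (F x)\<close>. The infimum over
  \<open>\<xi>\<close>, the supremum over \<open>x\<close> and the infimum over \<open>W\<close>
  then give the bound.\<close>

text \<open>Moves the operator norm out of both infima. For \<open>c = 0\<close> both sides vanish,
  even if the infimum is infinite; over an empty index set the left side would be infinite.\<close>

lemma ereal_INF_cmult_nonneg:
  fixes f :: "'a \<Rightarrow> ereal"
  assumes "I \<noteq> {}" and "0 \<le> c"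
  shows "(INF i\<in>I. ereal c * f i) = ereal c * (INF i\<in>I. f i)"
proof (cases "c = 0")
  case False
  with \<open>0 \<le> c\<close> have "0 < c" by simp
  moreover have "{ereal c * y |y. y \<in> f ` I} = (\<lambda>i. ereal c * f i) ` I"
    by auto
  ultimately show ?thesis
    using ereal_Inf_cmult[of c "\<lambda>y. y \<in> f ` I"] by simp
qed (use \<open>I \<noteq> {}\<close> in \<open>simp flip: zero_ereal_def\<close>)

lemma dim_image_le_finite_span:
  assumes "Vector_Spaces.linear s1 s2 f" and "finite B" and "V \<subseteq> module.span s1 B"
  shows "vector_space.dim s2 (f ` V) \<le> vector_space.dim s1 V"
proof -
  interpret f: Vector_Spaces.linear s1 s2 f by fact
  obtain C where C: "C \<subseteq> V" "f.vs1.independent C" "V \<subseteq> f.vs1.span C" "card C = f.vs1.dim V"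
    using f.vs1.basis_exists by metis
  have "finite C"
    using f.vs1.independent_span_bound[of B C] C assms by blast
  have "f ` V \<subseteq> f.vs2.span (f ` C)"
    using C(3) f.span_image by blast
  then have "f.vs2.dim (f ` V) \<le> card (f ` C)"
    using \<open>finite C\<close> by (intro f.vs2.dim_le_card) auto
  also have "\<dots> \<le> f.vs1.dim V"
    using card_image_le[OF \<open>finite C\<close>, of f] C(4) by simp
  finally show ?thesis .
qed

lemma affine_image_in_Aff:
  assumes "banach_space_over s1" and "banach_space_over s2"
    and "Vector_Spaces.linear s1 s2 f"
    and "W \<in> banach_space_over.Aff s1 n"
  shows "(\<lambda>\<xi>. a + f \<xi>) ` W \<in> banach_space_over.Aff s2 n"
proof -
  interpret X: banach_space_over s1 by fact
  interpret Y: banach_space_over s2 by fact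
  interpret f: Vector_Spaces.linear s1 s2 f by fact
  obtain c W0 B where W: "W = (\<lambda>w. c + w) ` W0" "X.subspace W0" "X.dim W0 \<le> n"
    and B: "finite B" "X.span B = W0"
    using assms(4) unfolding X.Aff_def by blast
  have "(\<lambda>\<xi>. a + f \<xi>) ` W = (\<lambda>w. (a + f c) + w) ` (f ` W0)"
    by (simp add: W(1) image_image f.add add.assoc)
  moreover have "Y.subspace (f ` W0)"
    using W(2) by (rule f.subspace_image)
  moreover have "finite (f ` B)" "Y.span (f ` B) = f ` W0"
    using B f.span_image by auto
  moreover have "Y.dim (f ` W0) \<le> n"
    using dim_image_le_finite_span[OF assms(3) B(1), of W0] B(2) W(3) by simp
  ultimately show ?thesis
    unfolding Y.Aff_def by blast
qed

theorem theorem3p2: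
  fixes scaleX :: "'k::real_normed_field \<Rightarrow> 'x::banach \<Rightarrow> 'x"
    and scaleY :: "'k \<Rightarrow> 'y::banach \<Rightarrow> 'y"
    and \<pi> \<pi>0 F :: "'x \<Rightarrow> 'y"
    and l0 :: 'y
    and K :: "'x set"
    and n :: nat
  assumes "banach_space_over scaleX"
    and "banach_space_over scaleY"
    and "Vector_Spaces.linear scaleX scaleY \<pi>0"
    and "bounded_linear \<pi>0"
    and "\<And>x. \<pi> x = l0 + \<pi>0 x + F x"
    and "K \<noteq> {}"
    and "bounded K"
    and "bounded (F ` K)"
    and "n \<ge> 1"
  shows "banach_space_over.affine_width scaleY n (\<pi> ` K)
    \<le> ereal (onorm \<pi>0) * banach_space_over.affine_width scaleX n K
      + (SUP x\<in>K. ereal (norm (F x)))"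
proof -
  interpret X: banach_space_over scaleX by fact
  interpret Y: banach_space_over scaleY by fact
  interpret \<pi>0: bounded_linear \<pi>0 by fact
  let ?c = "onorm \<pi>0" and ?M = "SUP x\<in>K. ereal (norm (F x))"
  let ?E = "\<lambda>W. SUP x\<in>K. INF \<xi>\<in>W. ereal (norm (x - \<xi>))"
  have c: "0 \<le> ?c"
    using assms(4) by (rule onorm_pos_le)
  obtain k where k: "k \<in> K"
    using assms(6) by blast
  \<comment> \<open>Nonnegativity of \<open>?M\<close> and \<open>?E W\<close> rules out sums of
    opposite infinities when \<open>?M\<close> is later pulled out of the infimum over
    \<open>W\<close>.\<close>
  have "0 \<le> ?M"
    using k by (rule SUP_upper2) simp
  have E_nonneg: "0 \<le> ?E W" for W
    using k by (rule SUP_upper2) (auto intro: INF_greatest)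
  \<comment> \<open>The single point 0 is an admissible affine subspace, so the infimum over
    \<open>X.Aff n\<close> is not over an empty set.\<close>
  have "X.subspace {0}" "X.span {} = {0}" "X.dim {0} \<le> n"
    using X.dim_le_card[of "{0}" "{}"] by auto
  then have "(\<lambda>w. 0 + w) ` {0} \<in> X.Aff n"
    unfolding X.Aff_def by blast
  then have Aff_ne: "X.Aff n \<noteq> {}" by blast
  have bound: "Y.affine_width n (\<pi> ` K) \<le> ereal ?c * ?E W + ?M" if W: "W \<in> X.Aff n" for W
  proof -
    have "W \<noteq> {}"
      using W X.subspace_0 unfolding X.Aff_def by blast
    let ?V = "(\<lambda>\<xi>. l0 + \<pi>0 \<xi>) ` W"
    have "(INF \<eta>\<in>?V. ereal (norm (\<pi> x - \<eta>))) \<le> ereal ?c * ?E W + ?M" if "x \<in> K" for x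
    proof -
      have "norm (\<pi> x - (l0 + \<pi>0 \<xi>)) \<le> ?c * norm (x - \<xi>) + norm (F x)" for \<xi>
      proof -
        have "\<pi> x - (l0 + \<pi>0 \<xi>) = \<pi>0 (x - \<xi>) + F x"
          by (simp add: assms(5) \<pi>0.diff)
        then show ?thesis
          using norm_triangle_ineq[of "\<pi>0 (x - \<xi>)" "F x"] onorm[OF assms(4), of "x - \<xi>"] by simp
      qed
      then have "(INF \<eta>\<in>?V. ereal (norm (\<pi> x - \<eta>)))
          \<le> (INF \<xi>\<in>W. ereal ?c * ereal (norm (x - \<xi>)) + ereal (norm (F x)))"
        unfolding image_image by (intro INF_superset_mono) auto
      also have "\<dots> = ereal ?c * (INF \<xi>\<in>W. ereal (norm (x - \<xi>))) + ereal (norm (F x))"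
        \<comment> \<open>The term \<open>norm (F x)\<close> does not depend on
          \<open>\<xi>\<close>, so it leaves the infimum as a constant.\<close>
        unfolding ereal_INF_cmult_nonneg[OF \<open>W \<noteq> {}\<close> c, symmetric]
        using \<open>W \<noteq> {}\<close> c by (intro INF_ereal_add_left) auto
      also have "\<dots> \<le> ereal ?c * ?E W + ?M"
        using c that by (intro add_mono ereal_mult_left_mono SUP_upper) auto
      finally show ?thesis .
    qed
    then have "(SUP y\<in>\<pi> ` K. INF \<eta>\<in>?V. ereal (norm (y - \<eta>))) \<le> ereal ?c * ?E W + ?M"
      unfolding image_image by (intro SUP_least) auto
    then show ?thesis
      \<comment> \<open>The width in the target is at most the error of the single competitor
        \<open>?V\<close>.\<close>
      unfolding Y.affine_width_def
      using affine_image_in_Aff[OF assms(1-3) W] by (rule INF_lower2[rotated])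
  qed
  have "Y.affine_width n (\<pi> ` K) \<le> (INF W\<in>X.Aff n. ereal ?c * ?E W + ?M)"
    using bound by (rule INF_greatest)
  also have "\<dots> = (INF W\<in>X.Aff n. ereal ?c * ?E W) + ?M"
    using Aff_ne c E_nonneg \<open>0 \<le> ?M\<close> by (intro INF_ereal_add_left) auto
  also have "\<dots> = ereal ?c * X.affine_width n K + ?M"
    using Aff_ne c by (simp add: ereal_INF_cmult_nonneg X.affine_width_def)
  finally show ?thesis .
qed

end
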